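(* For every sequent $\Gamma\Rightarrow\alpha$ of the calculus $\mathsf{Gb}$: $\vdash_{\mathsf{Gb}}\Gamma\Rightarrow\alpha$ if and only if $\Gamma\Rightarrow\alpha$ is valid in the class of all bounded commutative bi-residuated lattice-ordered semigroups, i.e. $\mathsf{Gb}$ is sound and complete with respect to this class.
   Context: A bounded commutative bi-residuated lattice-ordered semigroup ($cb\mathcal{RL^-}$) is an algebra $(A,\wedge,\vee,\cdot,\backslash,\ast,\rightarrow,\bot,\top)$ such that $(A,\wedge,\vee)$ is a lattice with order $\le$, least element $\bot$, greatest element $\top$; $(A,\cdot)$ is a commutative semigroup with $a\cdot b\le c$ iff $b\le a\backslash c$; $\ast$ is a commutative (not necessarily associative) binary operation with $a\ast b\le c$ iff $b\le a\rightarrow c$; and if $(a\cdot b)\ast c=\bot$ then $(a\cdot c)\ast b=\bot$, for all $a,b,c$. Formulas of $\mathsf{Gb}$: variables $p$, the constant $\bot$, and $\alpha\cdot\beta$, $\alpha\backslash\beta$, $\alpha\wedge\beta$, $\alpha\vee\beta$, $\alpha\ast\beta$, $\alpha\rightarrow\beta$ ($\neg\alpha$ abbreviates $\alpha\rightarrow\bot$, $\top$ abbreviates $\neg\bot$). Formula structures: every formula is a structure, and if $\Gamma,\Delta$ are structures so are $(\Gamma,\Delta)$ and $(\Gamma;\Delta)$. A context $\Gamma[-]$ is a structure with one designated hole; $\Gamma[\Delta]$ is the result of filling it with $\Delta$. A sequent is $\Gamma\Rightarrow\alpha$ with $\Gamma$ a structure and $\alpha$ a formula. $f(\Gamma)$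 is the formula obtained from $\Gamma$ by replacing "," by $\cdot$ and ";" by $\ast$. A valuation $\mu$ into a $cb\mathcal{RL^-}$ maps variables to elements and extends homomorphically ($\mu(\bot)=\bot$); $\Gamma\Rightarrow\alpha$ is valid if $\mu(f(\Gamma))\le\mu(\alpha)$ for all $cb\mathcal{RL^-}$ and all valuations. Rules of $\mathsf{Gb}$ (premises / conclusion): $(\mathrm{Id})$ $\alpha\Rightarrow\alpha$; $(\cdot\mathrm{L})$ $\Gamma[\alpha,\beta]\Rightarrow\gamma$ / $\Gamma[\alpha\cdot\beta]\Rightarrow\gamma$; $(\cdot\mathrm{R})$ $\Gamma_1\Rightarrow\alpha$, $\Gamma_2\Rightarrow\beta$ / $\Gamma_1,\Gamma_2\Rightarrow\alpha\cdot\beta$; $(\ast\mathrm{L})$ $\Gamma[\alpha;\beta]\Rightarrow\gamma$ / $\Gamma[\alpha\ast\beta]\Rightarrow\gamma$; $(\ast\mathrm{R})$ $\Gamma_1\Rightarrow\alpha$, $\Gamma_2\Rightarrow\beta$ / $\Gamma_1;\Gamma_2\Rightarrow\alpha\ast\beta$; $(\backslash\mathrm{L})$ $\Delta\Rightarrow\alpha$, $\Gamma[\beta]\Rightarrow\gamma$ / $\Gamma[\Delta,\alpha\backslash\beta]\Rightarrow\gamma$; $(\backslash\mathrm{R})$ $\alpha,\Gamma\Rightarrow\beta$ / $\Gamma\Rightarrow\alpha\backslash\beta$; $(\rightarrow\mathrm{L})$ $\Delta\Rightarrow\alpha$, $\Gamma[\beta]\Rightarrow\gamma$ / $\Gamma[\Delta;\alpha\rightarrow\beta]\Rightarrow\gamma$;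 $(\rightarrow\mathrm{R})$ $\alpha;\Gamma\Rightarrow\beta$ / $\Gamma\Rightarrow\alpha\rightarrow\beta$; $(\wedge\mathrm{L})$ $\Gamma[\alpha]\Rightarrow\beta$ / $\Gamma[\alpha\wedge\gamma]\Rightarrow\beta$ and $\Gamma[\alpha]\Rightarrow\beta$ / $\Gamma[\gamma\wedge\alpha]\Rightarrow\beta$; $(\wedge\mathrm{R})$ $\Gamma\Rightarrow\alpha$, $\Gamma\Rightarrow\beta$ / $\Gamma\Rightarrow\alpha\wedge\beta$; $(\vee\mathrm{L})$ $\Gamma[\alpha]\Rightarrow\gamma$, $\Gamma[\beta]\Rightarrow\gamma$ / $\Gamma[\alpha\vee\beta]\Rightarrow\gamma$; $(\vee\mathrm{R})$ $\Gamma\Rightarrow\alpha$ / $\Gamma\Rightarrow\alpha\vee\beta$ and $\Gamma\Rightarrow\alpha$ / $\Gamma\Rightarrow\beta\vee\alpha$; $(\bot)$ $\Delta\Rightarrow\bot$ / $\Gamma[\Delta]\Rightarrow\alpha$; $(\mathrm{Cut})$ $\Delta\Rightarrow\alpha$, $\Gamma[\alpha]\Rightarrow\beta$ / $\Gamma[\Delta]\Rightarrow\beta$; $(\mathrm{R}\text{-}\bot)$ $(\Delta_1,\Delta_2);\Delta_3\Rightarrow\bot$ / $(\Delta_1,\Delta_3);\Delta_2\Rightarrow\bot$; $(\mathrm{Ex})$ $\Gamma[\Delta_1,\Delta_2]\Rightarrow\beta$ / $\Gamma[\Delta_2,\Delta_1]\Rightarrow\beta$; $(\mathrm{Ex}^;)$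 $\Gamma[\Delta_1;\Delta_2]\Rightarrow\beta$ / $\Gamma[\Delta_2;\Delta_1]\Rightarrow\beta$; $(\mathrm{As}_1)$ $\Gamma[\Delta_1,(\Delta_2,\Delta_3)]\Rightarrow\beta$ / $\Gamma[(\Delta_1,\Delta_2),\Delta_3]\Rightarrow\beta$; $(\mathrm{As}_2)$ the converse of $(\mathrm{As}_1)$. *)

theory Defs
  imports Main
begin

text \<open>
  An algebra comes with an explicit carrier inside an ambient type, so that quantifying over
  \<open>'a cbrl_alg\<close> reaches algebras of every cardinality up to that of \<open>'a\<close>.
\<close>

record 'a cbrl_alg =
  carr :: "'a set"
  meet :: "'a \<Rightarrow> 'a \<Rightarrow> 'a"
  join :: "'a \<Rightarrow> 'a \<Rightarrow> 'a"
  fus :: "'a \<Rightarrow> 'a \<Rightarrow> 'a"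
  under :: "'a \<Rightarrow> 'a \<Rightarrow> 'a"
  star :: "'a \<Rightarrow> 'a \<Rightarrow> 'a"
  arrow :: "'a \<Rightarrow> 'a \<Rightarrow> 'a"
  bottom :: "'a"
  topel :: "'a"

definition leq :: "'a cbrl_alg \<Rightarrow> 'a \<Rightarrow> 'a \<Rightarrow> bool" where
  "leq M a b \<longleftrightarrow> meet M a b = a"

locale cbrl =
  fixes M :: "'a cbrl_alg"
  assumes meet_closed: "a \<in> carr M \<Longrightarrow> b \<in> carr M \<Longrightarrow> meet M a b \<in> carr M"
    and join_closed: "a \<in> carr M \<Longrightarrow> b \<in> carr M \<Longrightarrow> join M a b \<in> carr M"
    and fus_closed: "a \<in> carr M \<Longrightarrow> b \<in> carr M \<Longrightarrow> fus M a b \<in> carr M"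
    and under_closed: "a \<in> carr M \<Longrightarrow> b \<in> carr M \<Longrightarrow> under M a b \<in> carr M"
    and star_closed: "a \<in> carr M \<Longrightarrow> b \<in> carr M \<Longrightarrow> star M a b \<in> carr M"
    and arrow_closed: "a \<in> carr M \<Longrightarrow> b \<in> carr M \<Longrightarrow> arrow M a b \<in> carr M"
    and bottom_closed: "bottom M \<in> carr M"
    and topel_closed: "topel M \<in> carr M"
    and meet_comm: "a \<in> carr M \<Longrightarrow> b \<in> carr M \<Longrightarrow> meet M a b = meet M b a"
    and join_comm: "a \<in> carr M \<Longrightarrow> b \<in> carr M \<Longrightarrow> join M a b = join M b a"
    and meet_assoc: "a \<in> carr M \<Longrightarrow> b \<in> carr M \<Longrightarrow> c \<in> carr M \<Longrightarrow>
      meet M (meet M a b) c = meet M a (meet M b c)"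
    and join_assoc: "a \<in> carr M \<Longrightarrow> b \<in> carr M \<Longrightarrow> c \<in> carr M \<Longrightarrow>
      join M (join M a b) c = join M a (join M b c)"
    and meet_absorb: "a \<in> carr M \<Longrightarrow> b \<in> carr M \<Longrightarrow> meet M a (join M a b) = a"
    and join_absorb: "a \<in> carr M \<Longrightarrow> b \<in> carr M \<Longrightarrow> join M a (meet M a b) = a"
    and bottom_least: "a \<in> carr M \<Longrightarrow> leq M (bottom M) a"
    and topel_greatest: "a \<in> carr M \<Longrightarrow> leq M a (topel M)"
    and fus_assoc: "a \<in> carr M \<Longrightarrow> b \<in> carr M \<Longrightarrow> c \<in> carr M \<Longrightarrow>
      fus M (fus M a b) c = fus M a (fus M b c)"
    and fus_comm: "a \<in> carr M \<Longrightarrow> b \<in> carr M \<Longrightarrow> fus M a b = fus M b a"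
    and fus_residuated: "a \<in> carr M \<Longrightarrow> b \<in> carr M \<Longrightarrow> c \<in> carr M \<Longrightarrow>
      leq M (fus M a b) c \<longleftrightarrow> leq M b (under M a c)"
    and star_comm: "a \<in> carr M \<Longrightarrow> b \<in> carr M \<Longrightarrow> star M a b = star M b a"
    and star_residuated: "a \<in> carr M \<Longrightarrow> b \<in> carr M \<Longrightarrow> c \<in> carr M \<Longrightarrow>
      leq M (star M a b) c \<longleftrightarrow> leq M b (arrow M a c)"
    and fus_star_swap: "a \<in> carr M \<Longrightarrow> b \<in> carr M \<Longrightarrow> c \<in> carr M \<Longrightarrow>
      star M (fus M a b) c = bottom M \<Longrightarrow> star M (fus M a c) b = bottom M"

datatype 'v fm =
    Var 'v
  | Bot
  | Fus "'v fm" "'v fm"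
  | Under "'v fm" "'v fm"
  | And "'v fm" "'v fm"
  | Or "'v fm" "'v fm"
  | Star "'v fm" "'v fm"
  | Arrow "'v fm" "'v fm"

datatype 'v struct =
    Fm "'v fm"
  | Comma "'v struct" "'v struct"
  | Semi "'v struct" "'v struct"

datatype 'v ctx =
    Hole
  | CommaL "'v ctx" "'v struct"
  | CommaR "'v struct" "'v ctx"
  | SemiL "'v ctx" "'v struct"
  | SemiR "'v struct" "'v ctx"

primrec fill :: "'v ctx \<Rightarrow> 'v struct \<Rightarrow> 'v struct" where
  "fill Hole X = X"
| "fill (CommaL G Y) X = Comma (fill G X) Y"
| "fill (CommaR Y G) X = Comma Y (fill G X)"
| "fill (SemiL G Y) X = Semi (fill G X) Y"
| "fill (SemiR Y G) X = Semi Y (fill G X)"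

inductive Gb :: "'v struct \<Rightarrow> 'v fm \<Rightarrow> bool" where
  Id: "Gb (Fm \<alpha>) \<alpha>"
| FusL: "Gb (fill \<Gamma> (Comma (Fm \<alpha>) (Fm \<beta>))) \<gamma> \<Longrightarrow> Gb (fill \<Gamma> (Fm (Fus \<alpha> \<beta>))) \<gamma>"
| FusR: "Gb \<Gamma>1 \<alpha> \<Longrightarrow> Gb \<Gamma>2 \<beta> \<Longrightarrow> Gb (Comma \<Gamma>1 \<Gamma>2) (Fus \<alpha> \<beta>)"
| StarL: "Gb (fill \<Gamma> (Semi (Fm \<alpha>) (Fm \<beta>))) \<gamma> \<Longrightarrow> Gb (fill \<Gamma> (Fm (Star \<alpha> \<beta>))) \<gamma>"
| StarR: "Gb \<Gamma>1 \<alpha> \<Longrightarrow> Gb \<Gamma>2 \<beta> \<Longrightarrow> Gb (Semi \<Gamma>1 \<Gamma>2) (Star \<alpha> \<beta>)"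
| UnderL: "Gb \<Delta> \<alpha> \<Longrightarrow> Gb (fill \<Gamma> (Fm \<beta>)) \<gamma> \<Longrightarrow> Gb (fill \<Gamma> (Comma \<Delta> (Fm (Under \<alpha> \<beta>)))) \<gamma>"
| UnderR: "Gb (Comma (Fm \<alpha>) \<Gamma>) \<beta> \<Longrightarrow> Gb \<Gamma> (Under \<alpha> \<beta>)"
| ArrowL: "Gb \<Delta> \<alpha> \<Longrightarrow> Gb (fill \<Gamma> (Fm \<beta>)) \<gamma> \<Longrightarrow> Gb (fill \<Gamma> (Semi \<Delta> (Fm (Arrow \<alpha> \<beta>)))) \<gamma>"
| ArrowR: "Gb (Semi (Fm \<alpha>) \<Gamma>) \<beta> \<Longrightarrow> Gb \<Gamma> (Arrow \<alpha> \<beta>)"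
| AndL1: "Gb (fill \<Gamma> (Fm \<alpha>)) \<beta> \<Longrightarrow> Gb (fill \<Gamma> (Fm (And \<alpha> \<gamma>))) \<beta>"
| AndL2: "Gb (fill \<Gamma> (Fm \<alpha>)) \<beta> \<Longrightarrow> Gb (fill \<Gamma> (Fm (And \<gamma> \<alpha>))) \<beta>"
| AndR: "Gb \<Gamma> \<alpha> \<Longrightarrow> Gb \<Gamma> \<beta> \<Longrightarrow> Gb \<Gamma> (And \<alpha> \<beta>)"
| OrL: "Gb (fill \<Gamma> (Fm \<alpha>)) \<gamma> \<Longrightarrow> Gb (fill \<Gamma> (Fm \<beta>)) \<gamma> \<Longrightarrow> Gb (fill \<Gamma> (Fm (Or \<alpha> \<beta>))) \<gamma>"
| OrR1: "Gb \<Gamma> \<alpha> \<Longrightarrow> Gb \<Gamma> (Or \<alpha> \<beta>)"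
| OrR2: "Gb \<Gamma> \<alpha> \<Longrightarrow> Gb \<Gamma> (Or \<beta> \<alpha>)"
| BotE: "Gb \<Delta> Bot \<Longrightarrow> Gb (fill \<Gamma> \<Delta>) \<alpha>"
| Cut: "Gb \<Delta> \<alpha> \<Longrightarrow> Gb (fill \<Gamma> (Fm \<alpha>)) \<beta> \<Longrightarrow> Gb (fill \<Gamma> \<Delta>) \<beta>"
| RBot: "Gb (Semi (Comma \<Delta>1 \<Delta>2) \<Delta>3) Bot \<Longrightarrow> Gb (Semi (Comma \<Delta>1 \<Delta>3) \<Delta>2) Bot"
| Ex: "Gb (fill \<Gamma> (Comma \<Delta>1 \<Delta>2)) \<beta> \<Longrightarrow> Gb (fill \<Gamma> (Comma \<Delta>2 \<Delta>1)) \<beta>"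
| ExSemi: "Gb (fill \<Gamma> (Semi \<Delta>1 \<Delta>2)) \<beta> \<Longrightarrow> Gb (fill \<Gamma> (Semi \<Delta>2 \<Delta>1)) \<beta>"
| As1: "Gb (fill \<Gamma> (Comma \<Delta>1 (Comma \<Delta>2 \<Delta>3))) \<beta> \<Longrightarrow> Gb (fill \<Gamma> (Comma (Comma \<Delta>1 \<Delta>2) \<Delta>3)) \<beta>"
| As2: "Gb (fill \<Gamma> (Comma (Comma \<Delta>1 \<Delta>2) \<Delta>3)) \<beta> \<Longrightarrow> Gb (fill \<Gamma> (Comma \<Delta>1 (Comma \<Delta>2 \<Delta>3))) \<beta>"

primrec fm_of :: "'v struct \<Rightarrow> 'v fm" where
  "fm_of (Fm \<alpha>) = \<alpha>"
| "fm_of (Comma \<Gamma> \<Delta>) = Fus (fm_of \<Gamma>) (fm_of \<Delta>)"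
| "fm_of (Semi \<Gamma> \<Delta>) = Star (fm_of \<Gamma>) (fm_of \<Delta>)"

primrec val :: "'a cbrl_alg \<Rightarrow> ('v \<Rightarrow> 'a) \<Rightarrow> 'v fm \<Rightarrow> 'a" where
  "val M \<mu> (Var p) = \<mu> p"
| "val M \<mu> Bot = bottom M"
| "val M \<mu> (Fus \<alpha> \<beta>) = fus M (val M \<mu> \<alpha>) (val M \<mu> \<beta>)"
| "val M \<mu> (Under \<alpha> \<beta>) = under M (val M \<mu> \<alpha>) (val M \<mu> \<beta>)"
| "val M \<mu> (And \<alpha> \<beta>) = meet M (val M \<mu> \<alpha>) (val M \<mu> \<beta>)"
| "val M \<mu> (Or \<alpha> \<beta>) = join M (val M \<mu> \<alpha>) (val M \<mu> \<beta>)"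
| "val M \<mu> (Star \<alpha> \<beta>) = star M (val M \<mu> \<alpha>) (val M \<mu> \<beta>)"
| "val M \<mu> (Arrow \<alpha> \<beta>) = arrow M (val M \<mu> \<alpha>) (val M \<mu> \<beta>)"

text \<open>
  HOL formulas cannot quantify over types, so validity is relative to the ambient type of the
  carriers; validity in the class of all algebras is validity for every type \<open>'a\<close>.
\<close>

definition valid :: "'a itself \<Rightarrow> 'v struct \<Rightarrow> 'v fm \<Rightarrow> bool" where
  "valid (_ :: 'a itself) \<Gamma> \<alpha> \<longleftrightarrow>
    (\<forall>(M :: 'a cbrl_alg) \<mu>. cbrl M \<longrightarrow> (\<forall>p. \<mu> p \<in> carr M) \<longrightarrow>
      leq M (val M \<mu> (fm_of \<Gamma>)) (val M \<mu> \<alpha>))"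

end

theory Submission
  imports Defs
begin

text \<open>
  Soundness: for fixed \<open>\<Gamma>\<close> and \<open>c\<close> in an algebra, residuation turns \<open>\<Gamma>[x] \<le> c\<close> into \<open>x \<le> r\<close> for a
  suitable element \<open>r\<close>, so every left rule reduces to an inequality outside any context.
  Completeness: the Lindenbaum algebra, with the class of a formula \<open>\<alpha>\<close> represented by the principal
  down-set \<open>{\<beta>. \<turnstile> \<beta> \<Rightarrow> \<alpha>}\<close>, satisfies all axioms and refutes every underivable sequent.
\<close>

section \<open>Soundness\<close>

context cbrl
begin

section \<open>Order and lattice facts, with the order read off from \<open>meet\<close>\<close>

lemma meet_idem: "a \<in> carr M \<Longrightarrow> meet M a a = a"
  using meet_absorb[of a "meet M a a"] join_absorb[of a a] meet_closed[of a a] by simp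

lemma leq_refl: "a \<in> carr M \<Longrightarrow> leq M a a"
  by (simp add: leq_def meet_idem)

lemma leq_trans:
  assumes "leq M a b" "leq M b c" "a \<in> carr M" "b \<in> carr M" "c \<in> carr M"
  shows "leq M a c"
  using assms meet_assoc[of a b c] by (simp add: leq_def)

lemma leq_antisym:
  assumes "leq M a b" "leq M b a" "a \<in> carr M" "b \<in> carr M"
  shows "a = b"
  using assms meet_comm[of a b] by (simp add: leq_def)

lemma meet_leq1:
  assumes "a \<in> carr M" "b \<in> carr M"
  shows "leq M (meet M a b) a"
  unfolding leq_def
  using assms by (metis meet_assoc meet_closed meet_comm meet_idem)

lemma meet_leq2: "a \<in> carr M \<Longrightarrow> b \<in> carr M \<Longrightarrow> leq M (meet M a b) b"
  using meet_leq1[of b a] by (simp add: meet_comm)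

lemma leq_meet:
  assumes "leq M c a" "leq M c b" "a \<in> carr M" "b \<in> carr M" "c \<in> carr M"
  shows "leq M c (meet M a b)"
  using assms meet_assoc[of c a b] by (simp add: leq_def)

text \<open>Absorption turns the definition of the order through \<open>meet\<close> into the dual
  one through \<open>join\<close>, so that \<open>join_leq\<close> can be proved like
  \<open>leq_meet\<close>.\<close>

lemma leq_iff_join:
  assumes "a \<in> carr M" "b \<in> carr M"
  shows "leq M a b \<longleftrightarrow> join M a b = b"
  unfolding leq_def using assms
  by (metis join_absorb join_comm meet_absorb meet_comm)

lemma leq_join1: "a \<in> carr M \<Longrightarrow> b \<in> carr M \<Longrightarrow> leq M a (join M a b)"
  by (simp add: leq_def meet_absorb)

lemma leq_join2: "a \<in> carr M \<Longrightarrow> b \<in> carr M \<Longrightarrow> leq M b (join M a b)"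
  using leq_join1[of b a] by (simp add: join_comm)

lemma join_leq:
  assumes "leq M a c" "leq M b c" "a \<in> carr M" "b \<in> carr M" "c \<in> carr M"
  shows "leq M (join M a b) c"
  using assms join_assoc[of a b c] by (simp add: leq_iff_join join_closed)

text \<open>Monotonicity is not an axiom: residuation gives it in the right argument, and
  commutativity carries it over to the left one.\<close>

lemma fus_mono:
  assumes "leq M a a'" "leq M b b'" "a \<in> carr M" "a' \<in> carr M" "b \<in> carr M" "b' \<in> carr M"
  shows "leq M (fus M a b) (fus M a' b')"
proof -
  have right: "leq M (fus M x y) (fus M x y')"
    if "leq M y y'" "x \<in> carr M" "y \<in> carr M" "y' \<in> carr M" for x y y'
  proof -
    \<comment> \<open>The unit of the adjunction: residuate the trivial inequality
      \<open>fus M x y'\<close> \<le> \<open>fus M x y'\<close>.\<close>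
    have "leq M y' (under M x (fus M x y'))"
      using that fus_residuated[of x y' "fus M x y'"] by (simp add: fus_closed leq_refl)
    then have "leq M y (under M x (fus M x y'))"
      using that by (blast intro: leq_trans under_closed fus_closed)
    then show ?thesis
      using that by (simp add: fus_residuated fus_closed)
  qed
  have "leq M (fus M a b) (fus M a b')" "leq M (fus M b' a) (fus M b' a')"
    using assms by (simp_all add: right)
  \<comment> \<open>The two inequalities are chained through
    \<open>fus M a b' = fus M b' a\<close>.\<close>
  then show ?thesis
    using assms by (metis leq_trans fus_comm fus_closed)
qed

text \<open>The argument for \<open>fus_mono\<close> relies on residuation and commutativity only,
  so it carries over to the possibly non-associative \<open>star\<close>.\<close>

lemma star_mono:
  assumes "leq M a a'" "leq M b b'" "a \<in> carr M" "a' \<in> carr M" "b \<in> carr M" "b' \<in> carr M"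
  shows "leq M (star M a b) (star M a' b')"
proof -
  have right: "leq M (star M x y) (star M x y')"
    if "leq M y y'" "x \<in> carr M" "y \<in> carr M" "y' \<in> carr M" for x y y'
  proof -
    have "leq M y' (arrow M x (star M x y'))"
      using that star_residuated[of x y' "star M x y'"] by (simp add: star_closed leq_refl)
    then have "leq M y (arrow M x (star M x y'))"
      using that by (blast intro: leq_trans arrow_closed star_closed)
    then show ?thesis
      using that by (simp add: star_residuated star_closed)
  qed
  have "leq M (star M a b) (star M a b')" "leq M (star M b' a) (star M b' a')"
    using assms by (simp_all add: right)
  then show ?thesis
    using assms by (metis leq_trans star_comm star_closed)
qed

section \<open>Valuations of structures in context\<close>

lemma val_closed:
  assumes "\<And>p. \<mu> p \<in> carr M"
  shows "val M \<mu> \<alpha> \<in> carr M"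
  by (induction \<alpha>) (simp_all add: assms meet_closed join_closed fus_closed under_closed
      star_closed arrow_closed bottom_closed)

text \<open>Each layer of \<Gamma> has a side structure that residuation moves to the right of the
  inequality. The resulting bound \<open>r\<close> does not depend on what fills the hole, so
  several fillings can be compared with the same \<open>r\<close>.\<close>

lemma context_residual:
  assumes \<mu>: "\<And>p. \<mu> p \<in> carr M" and c: "c \<in> carr M"
  obtains r where "r \<in> carr M"
    "\<And>\<Delta>. leq M (val M \<mu> (fm_of (fill \<Gamma> \<Delta>))) c \<longleftrightarrow> leq M (val M \<mu> (fm_of \<Delta>)) r"
proof -
  note cl = val_closed[of \<mu>, OF \<mu>]
  have "\<exists>r\<in>carr M. \<forall>\<Delta>. leq M (val M \<mu> (fm_of (fill \<Gamma> \<Delta>))) c \<longleftrightarrow> leq M (val M \<mu> (fm_of \<Delta>)) r"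
    using c
  \<comment> \<open>The bound \<open>c\<close> must vary, since removing the outer layer replaces it
    by a residual; at \<open>Hole\<close> the current bound itself is \<open>r\<close>.\<close>
  proof (induction \<Gamma> arbitrary: c)
    case Hole
    then show ?case by auto
  next
    case (CommaL \<Gamma> Y)
    \<comment> \<open>Residuation isolates the right factor, while the hole lies in the left one;
      \<open>fus_comm\<close> exchanges them first.\<close>
    have "leq M (val M \<mu> (fm_of (fill (CommaL \<Gamma> Y) \<Delta>))) c \<longleftrightarrow>
        leq M (val M \<mu> (fm_of (fill \<Gamma> \<Delta>))) (under M (val M \<mu> (fm_of Y)) c)" for \<Delta>
      using CommaL.prems fus_comm[OF cl cl] by (metis cl fill.simps(2) fm_of.simps(2) fus_residuated val.simps(3))
    then show ?case
      using CommaL.IH[OF under_closed[OF cl CommaL.prems]] by simp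
  next
    case (CommaR Y \<Gamma>)
    have "leq M (val M \<mu> (fm_of (fill (CommaR Y \<Gamma>) \<Delta>))) c \<longleftrightarrow>
        leq M (val M \<mu> (fm_of (fill \<Gamma> \<Delta>))) (under M (val M \<mu> (fm_of Y)) c)" for \<Delta>
      using fus_residuated CommaR.prems cl by simp
    then show ?case
      using CommaR.IH[OF under_closed[OF cl CommaR.prems]] by simp
  next
    case (SemiL \<Gamma> Y)
    have "leq M (val M \<mu> (fm_of (fill (SemiL \<Gamma> Y) \<Delta>))) c \<longleftrightarrow>
        leq M (val M \<mu> (fm_of (fill \<Gamma> \<Delta>))) (arrow M (val M \<mu> (fm_of Y)) c)" for \<Delta>
      using SemiL.prems star_comm[OF cl cl] by (metis cl fill.simps(4) fm_of.simps(3) star_residuated val.simps(7))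
    then show ?case
      using SemiL.IH[OF arrow_closed[OF cl SemiL.prems]] by simp
  next
    case (SemiR Y \<Gamma>)
    have "leq M (val M \<mu> (fm_of (fill (SemiR Y \<Gamma>) \<Delta>))) c \<longleftrightarrow>
        leq M (val M \<mu> (fm_of (fill \<Gamma> \<Delta>))) (arrow M (val M \<mu> (fm_of Y)) c)" for \<Delta>
      using star_residuated SemiR.prems cl by simp
    then show ?case
      using SemiR.IH[OF arrow_closed[OF cl SemiR.prems]] by simp
  qed
  then show ?thesis
    using that by blast
qed

text \<open>This is the form that suits rules whose conclusion arises from a premise by replacing
  one piece inside a context: only the two pieces have to be compared.\<close>

lemma context_antimono:
  assumes \<mu>: "\<And>p. \<mu> p \<in> carr M" and c: "c \<in> carr M"
    and "leq M (val M \<mu> (fm_of (fill \<Gamma> \<Delta>))) c"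
    and "leq M (val M \<mu> (fm_of \<Delta>')) (val M \<mu> (fm_of \<Delta>))"
  shows "leq M (val M \<mu> (fm_of (fill \<Gamma> \<Delta>'))) c"
proof -
  obtain r where "r \<in> carr M"
    "\<And>\<Delta>. leq M (val M \<mu> (fm_of (fill \<Gamma> \<Delta>))) c \<longleftrightarrow> leq M (val M \<mu> (fm_of \<Delta>)) r"
    using context_residual[of \<mu>, OF \<mu> c] by blast
  then show ?thesis
    using assms(3,4) val_closed[of \<mu>, OF \<mu>] by (metis leq_trans)
qed

lemma Gb_sound:
  assumes \<mu>: "\<And>p. \<mu> p \<in> carr M"
  shows "Gb \<Gamma> \<alpha> \<Longrightarrow> leq M (val M \<mu> (fm_of \<Gamma>)) (val M \<mu> \<alpha>)"
proof (induction rule: Gb.induct)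
  note cl[simp] = val_closed[of \<mu>, OF \<mu>]
  note mono = context_antimono[of \<mu>, OF \<mu> cl]
  {
    case (Id \<alpha>)
    show ?case by (simp add: leq_refl)
  next
    case (FusL \<Gamma> \<alpha> \<beta> \<gamma>)
    show ?case by (rule mono[OF FusL.IH]) (simp add: leq_refl fus_closed)
  next
    case (FusR \<Gamma>1 \<alpha> \<Gamma>2 \<beta>)
    then show ?case by (simp add: fus_mono)
  next
    case (StarL \<Gamma> \<alpha> \<beta> \<gamma>)
    show ?case by (rule mono[OF StarL.IH]) (simp add: leq_refl star_closed)
  next
    case (StarR \<Gamma>1 \<alpha> \<Gamma>2 \<beta>)
    then show ?case by (simp add: star_mono)
  next
    case (UnderL \<Delta> \<alpha> \<Gamma> \<beta> \<gamma>)
    \<comment> \<open>Modus ponens in the algebra, the counit of the adjunction; the first premise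
      then replaces \<alpha> by \<Delta>.\<close>
    have "leq M (fus M (val M \<mu> \<alpha>) (val M \<mu> (Under \<alpha> \<beta>))) (val M \<mu> \<beta>)"
      by (simp add: fus_residuated leq_refl under_closed)
    moreover have "leq M (fus M (val M \<mu> (fm_of \<Delta>)) (val M \<mu> (Under \<alpha> \<beta>)))
        (fus M (val M \<mu> \<alpha>) (val M \<mu> (Under \<alpha> \<beta>)))"
      by (rule fus_mono[OF UnderL.IH(1) leq_refl]) (rule cl)+
    ultimately have "leq M (val M \<mu> (fm_of (Comma \<Delta> (Fm (Under \<alpha> \<beta>))))) (val M \<mu> (fm_of (Fm \<beta>)))"
      unfolding fm_of.simps val.simps(3) by (metis leq_trans fus_closed cl)
    then show ?case by (rule mono[OF UnderL.IH(2)])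
  next
    case (UnderR \<alpha> \<Gamma> \<beta>)
    then show ?case by (simp add: fus_residuated)
  next
    case (ArrowL \<Delta> \<alpha> \<Gamma> \<beta> \<gamma>)
    have "leq M (star M (val M \<mu> \<alpha>) (val M \<mu> (Arrow \<alpha> \<beta>))) (val M \<mu> \<beta>)"
      by (simp add: star_residuated leq_refl arrow_closed)
    moreover have "leq M (star M (val M \<mu> (fm_of \<Delta>)) (val M \<mu> (Arrow \<alpha> \<beta>)))
        (star M (val M \<mu> \<alpha>) (val M \<mu> (Arrow \<alpha> \<beta>)))"
      by (rule star_mono[OF ArrowL.IH(1) leq_refl]) (rule cl)+
    ultimately have "leq M (val M \<mu> (fm_of (Semi \<Delta> (Fm (Arrow \<alpha> \<beta>))))) (val M \<mu> (fm_of (Fm \<beta>)))"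
      unfolding fm_of.simps val.simps(7) by (metis leq_trans star_closed cl)
    then show ?case by (rule mono[OF ArrowL.IH(2)])
  next
    case (ArrowR \<alpha> \<Gamma> \<beta>)
    then show ?case by (simp add: star_residuated)
  next
    case (AndL1 \<Gamma> \<alpha> \<beta> \<gamma>)
    show ?case by (rule mono[OF AndL1.IH]) (simp add: meet_leq1)
  next
    case (AndL2 \<Gamma> \<alpha> \<beta> \<gamma>)
    show ?case by (rule mono[OF AndL2.IH]) (simp add: meet_leq2)
  next
    case (AndR \<Gamma> \<alpha> \<beta>)
    then show ?case by (simp add: leq_meet)
  next
    case (OrL \<Gamma> \<alpha> \<gamma> \<beta>)
    \<comment> \<open>Both premises share the context, hence the same \<open>r\<close> bounds both
      disjuncts and so their join.\<close>
    obtain r where "r \<in> carr M"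
      "\<And>\<Delta>. leq M (val M \<mu> (fm_of (fill \<Gamma> \<Delta>))) (val M \<mu> \<gamma>) \<longleftrightarrow> leq M (val M \<mu> (fm_of \<Delta>)) r"
      using context_residual[of \<mu>, OF \<mu> cl] by blast
    with OrL.IH show ?case by (simp add: join_leq)
  next
    case (OrR1 \<Gamma> \<alpha> \<beta>)
    then show ?case using leq_join1[OF cl cl] by (simp, metis leq_trans join_closed cl)
  next
    case (OrR2 \<Gamma> \<alpha> \<beta>)
    then show ?case using leq_join2[OF cl cl] by (simp, metis leq_trans join_closed cl)
  next
    case (BotE \<Delta> \<Gamma> \<alpha>)
    obtain r where r: "r \<in> carr M"
      "\<And>\<Delta>. leq M (val M \<mu> (fm_of (fill \<Gamma> \<Delta>))) (val M \<mu> \<alpha>) \<longleftrightarrow> leq M (val M \<mu> (fm_of \<Delta>)) r"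
      using context_residual[of \<mu>, OF \<mu> cl] by blast
    \<comment> \<open>The premise forces the value of \<Delta> below \<open>bottom M\<close>, which
      lies below any residual.\<close>
    have "leq M (val M \<mu> (fm_of \<Delta>)) r"
      using BotE.IH bottom_least[OF r(1)] leq_trans[OF _ _ cl bottom_closed r(1)] by simp
    with r show ?case by simp
  next
    case (Cut \<Delta> \<alpha> \<Gamma> \<beta>)
    show ?case by (rule mono[OF Cut.IH(2)]) (simp add: Cut.IH(1))
  next
    case (RBot \<Delta>1 \<Delta>2 \<Delta>3)
    \<comment> \<open>The swap axiom speaks of equality with \<open>bottom M\<close>; antisymmetry
      upgrades the inequality given by the premise.\<close>
    then have "star M (fus M (val M \<mu> (fm_of \<Delta>1)) (val M \<mu> (fm_of \<Delta>2))) (val M \<mu> (fm_of \<Delta>3)) = bottom M"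
      by (simp add: leq_antisym bottom_least star_closed fus_closed bottom_closed)
    then have "star M (fus M (val M \<mu> (fm_of \<Delta>1)) (val M \<mu> (fm_of \<Delta>3))) (val M \<mu> (fm_of \<Delta>2)) = bottom M"
      by (simp add: fus_star_swap)
    then show ?case by (simp add: leq_refl bottom_closed)
  next
    case (Ex \<Gamma> \<Delta>1 \<Delta>2 \<beta>)
    show ?case
      by (rule mono[OF Ex.IH]) (simp add: fus_comm[of "val M \<mu> (fm_of \<Delta>1)"] leq_refl fus_closed)
  next
    case (ExSemi \<Gamma> \<Delta>1 \<Delta>2 \<beta>)
    show ?case
      by (rule mono[OF ExSemi.IH]) (simp add: star_comm[of "val M \<mu> (fm_of \<Delta>1)"] leq_refl star_closed)
  next
    case (As1 \<Gamma> \<Delta>1 \<Delta>2 \<Delta>3 \<beta>)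
    show ?case by (rule mono[OF As1.IH]) (simp add: fus_assoc leq_refl fus_closed)
  next
    case (As2 \<Gamma> \<Delta>1 \<Delta>2 \<Delta>3 \<beta>)
    show ?case by (rule mono[OF As2.IH]) (simp add: fus_assoc leq_refl fus_closed)
  }
qed

end

lemma Gb_imp_valid: "Gb \<Gamma> \<alpha> \<Longrightarrow> valid TYPE('a) \<Gamma> \<alpha>"
  unfolding valid_def using cbrl.Gb_sound by blast


section \<open>The Lindenbaum algebra\<close>

abbreviation entails :: "'v fm \<Rightarrow> 'v fm \<Rightarrow> bool" (infix "\<turnstile>" 50) where
  "\<alpha> \<turnstile> \<beta> \<equiv> Gb (Fm \<alpha>) \<beta>"

lemma Gb_trans: "Gb \<Gamma> \<alpha> \<Longrightarrow> \<alpha> \<turnstile> \<beta> \<Longrightarrow> Gb \<Gamma> \<beta>"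
  using Cut[where \<Gamma> = Hole] by simp

text \<open>Cutting against this sequent leads back from the formula of a structure to the structure
  itself.\<close>

lemma Gb_fm_of: "Gb \<Gamma> (fm_of \<Gamma>)"
  by (induction \<Gamma>) (simp_all add: Id FusR StarR)

lemma entails_And_iff: "\<gamma> \<turnstile> And \<alpha> \<beta> \<longleftrightarrow> \<gamma> \<turnstile> \<alpha> \<and> \<gamma> \<turnstile> \<beta>"
  using AndL1[of Hole \<alpha> \<alpha> \<beta>] AndL2[of Hole \<beta> \<beta> \<alpha>]
  by (metis AndR Gb_trans Id fill.simps(1))

lemma Or_entails_iff: "Or \<alpha> \<beta> \<turnstile> \<gamma> \<longleftrightarrow> \<alpha> \<turnstile> \<gamma> \<and> \<beta> \<turnstile> \<gamma>"
  using OrL[of Hole \<alpha> \<gamma> \<beta>]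
  by (metis Gb_trans Id OrR1 OrR2 fill.simps(1))

text \<open>The left rule is invertible: cut with the sequent that \<open>FusR\<close> builds from
  two identities.\<close>

lemma Fus_entails_iff: "Fus \<alpha> \<beta> \<turnstile> \<gamma> \<longleftrightarrow> Gb (Comma (Fm \<alpha>) (Fm \<beta>)) \<gamma>"
  using FusL[of Hole \<alpha> \<beta> \<gamma>] by (auto intro: Gb_trans[OF FusR[OF Id Id]])

lemma Star_entails_iff: "Star \<alpha> \<beta> \<turnstile> \<gamma> \<longleftrightarrow> Gb (Semi (Fm \<alpha>) (Fm \<beta>)) \<gamma>"
  using StarL[of Hole \<alpha> \<beta> \<gamma>] by (auto intro: Gb_trans[OF StarR[OF Id Id]])

text \<open>The direction from right to left cuts \<beta> into the modus ponens sequent supplied by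
  \<open>UnderL\<close>.\<close>

lemma Fus_entails_iff_Under: "Fus \<alpha> \<beta> \<turnstile> \<gamma> \<longleftrightarrow> \<beta> \<turnstile> Under \<alpha> \<gamma>"
proof
  assume "\<beta> \<turnstile> Under \<alpha> \<gamma>"
  moreover have "Gb (Comma (Fm \<alpha>) (Fm (Under \<alpha> \<gamma>))) \<gamma>"
    using UnderL[of "Fm \<alpha>" \<alpha> Hole \<gamma> \<gamma>] by (simp add: Id)
  ultimately show "Fus \<alpha> \<beta> \<turnstile> \<gamma>"
    using Cut[of "Fm \<beta>" "Under \<alpha> \<gamma>" "CommaR (Fm \<alpha>) Hole" \<gamma>] by (simp add: Fus_entails_iff)
qed (simp add: Fus_entails_iff UnderR)

lemma Star_entails_iff_Arrow: "Star \<alpha> \<beta> \<turnstile> \<gamma> \<longleftrightarrow> \<beta> \<turnstile> Arrow \<alpha> \<gamma>"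
proof
  assume "\<beta> \<turnstile> Arrow \<alpha> \<gamma>"
  moreover have "Gb (Semi (Fm \<alpha>) (Fm (Arrow \<alpha> \<gamma>))) \<gamma>"
    using ArrowL[of "Fm \<alpha>" \<alpha> Hole \<gamma> \<gamma>] by (simp add: Id)
  ultimately show "Star \<alpha> \<beta> \<turnstile> \<gamma>"
    using Cut[of "Fm \<beta>" "Arrow \<alpha> \<gamma>" "SemiR (Fm \<alpha>) Hole" \<gamma>] by (simp add: Star_entails_iff)
qed (simp add: Star_entails_iff ArrowR)

lemma Fus_mono: "\<alpha> \<turnstile> \<alpha>' \<Longrightarrow> \<beta> \<turnstile> \<beta>' \<Longrightarrow> Fus \<alpha> \<beta> \<turnstile> Fus \<alpha>' \<beta>'"
  by (simp add: Fus_entails_iff FusR)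

lemma Star_mono: "\<alpha> \<turnstile> \<alpha>' \<Longrightarrow> \<beta> \<turnstile> \<beta>' \<Longrightarrow> Star \<alpha> \<beta> \<turnstile> Star \<alpha>' \<beta>'"
  by (simp add: Star_entails_iff StarR)

lemma Under_mono: "\<alpha>' \<turnstile> \<alpha> \<Longrightarrow> \<beta> \<turnstile> \<beta>' \<Longrightarrow> Under \<alpha> \<beta> \<turnstile> Under \<alpha>' \<beta>'"
  by (metis Fus_entails_iff_Under Fus_mono Gb_trans Id)

lemma Arrow_mono: "\<alpha>' \<turnstile> \<alpha> \<Longrightarrow> \<beta> \<turnstile> \<beta>' \<Longrightarrow> Arrow \<alpha> \<beta> \<turnstile> Arrow \<alpha>' \<beta>'"
  by (metis Star_entails_iff_Arrow Star_mono Gb_trans Id)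

lemma And_mono: "\<alpha> \<turnstile> \<alpha>' \<Longrightarrow> \<beta> \<turnstile> \<beta>' \<Longrightarrow> And \<alpha> \<beta> \<turnstile> And \<alpha>' \<beta>'"
  by (metis entails_And_iff Gb_trans Id)

lemma Or_mono: "\<alpha> \<turnstile> \<alpha>' \<Longrightarrow> \<beta> \<turnstile> \<beta>' \<Longrightarrow> Or \<alpha> \<beta> \<turnstile> Or \<alpha>' \<beta>'"
  by (metis Or_entails_iff Gb_trans Id)

lemma Fus_comm: "Fus \<alpha> \<beta> \<turnstile> Fus \<beta> \<alpha>"
  using Ex[of Hole "Fm \<beta>" "Fm \<alpha>" "Fus \<beta> \<alpha>"] by (simp add: Fus_entails_iff FusR Id)

lemma Star_comm: "Star \<alpha> \<beta> \<turnstile> Star \<beta> \<alpha>"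
  using ExSemi[of Hole "Fm \<beta>" "Fm \<alpha>" "Star \<beta> \<alpha>"] by (simp add: Star_entails_iff StarR Id)

lemma Fus_assoc1: "Fus (Fus \<alpha> \<beta>) \<gamma> \<turnstile> Fus \<alpha> (Fus \<beta> \<gamma>)"
proof -
  have "Gb (Comma (Comma (Fm \<alpha>) (Fm \<beta>)) (Fm \<gamma>)) (Fus \<alpha> (Fus \<beta> \<gamma>))"
    using As1[of Hole "Fm \<alpha>" "Fm \<beta>" "Fm \<gamma>"] by (simp add: FusR Id)
  then show ?thesis
    using FusL[of "CommaL Hole (Fm \<gamma>)" \<alpha> \<beta>] by (simp add: Fus_entails_iff)
qed

lemma Fus_assoc2: "Fus \<alpha> (Fus \<beta> \<gamma>) \<turnstile> Fus (Fus \<alpha> \<beta>) \<gamma>"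
proof -
  have "Gb (Comma (Fm \<alpha>) (Comma (Fm \<beta>) (Fm \<gamma>))) (Fus (Fus \<alpha> \<beta>) \<gamma>)"
    using As2[of Hole "Fm \<alpha>" "Fm \<beta>" "Fm \<gamma>"] by (simp add: FusR Id)
  then show ?thesis
    using FusL[of "CommaR (Fm \<alpha>) Hole" \<beta> \<gamma>] by (simp add: Fus_entails_iff)
qed

lemma Bot_entails: "Bot \<turnstile> \<alpha>"
  using BotE[of "Fm Bot" Hole \<alpha>] by (simp add: Id)

text \<open>By \<open>BotE\<close>, \<open>Bot\<close> next to any formula still yields
  \<open>Bot\<close>; \<open>ArrowR\<close> then moves that \<open>Bot\<close> to the right.\<close>

lemma entails_Top: "\<alpha> \<turnstile> Arrow Bot Bot"
  using BotE[of "Fm Bot" "SemiL Hole (Fm \<alpha>)" Bot] by (simp add: Id ArrowR)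

text \<open>\<open>RBot\<close> acts on structures, so the connectives are first unfolded by cut and
  afterwards restored by the left rules.\<close>

lemma Fus_Star_swap:
  assumes "Star (Fus \<alpha> \<beta>) \<gamma> \<turnstile> Bot"
  shows "Star (Fus \<alpha> \<gamma>) \<beta> \<turnstile> Bot"
proof -
  have "Gb (Semi (Comma (Fm \<alpha>) (Fm \<beta>)) (Fm \<gamma>)) Bot"
    by (rule Gb_trans[OF _ assms]) (simp add: StarR FusR Id)
  then have "Gb (Semi (Comma (Fm \<alpha>) (Fm \<gamma>)) (Fm \<beta>)) Bot"
    by (rule RBot)
  then show ?thesis
    using FusL[of "SemiL Hole (Fm \<beta>)" \<alpha> \<gamma>] by (simp add: Star_entails_iff)
qed

section \<open>Down-sets as elements of the Lindenbaum algebra\<close>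

definition down :: "'v fm \<Rightarrow> 'v fm set" where
  "down \<alpha> = {\<beta>. \<beta> \<turnstile> \<alpha>}"

text \<open>Identity and cut make \<open>down\<close> an order embedding of the derivability
  preorder, so its range serves as the quotient by interderivability.\<close>

lemma down_subset_iff: "down \<alpha> \<subseteq> down \<beta> \<longleftrightarrow> \<alpha> \<turnstile> \<beta>"
  unfolding down_def by (auto intro: Id Gb_trans)

lemma down_eq_iff: "down \<alpha> = down \<beta> \<longleftrightarrow> \<alpha> \<turnstile> \<beta> \<and> \<beta> \<turnstile> \<alpha>"
  by (simp add: set_eq_subset down_subset_iff)

text \<open>\<open>inv down\<close> chooses a representative, so the value is meaningful for
  arguments in the range of \<open>down\<close>.\<close>

definition lift_op :: "('v fm \<Rightarrow> 'v fm \<Rightarrow> 'v fm) \<Rightarrow> 'v fm set \<Rightarrow> 'v fm set \<Rightarrow> 'v fm set" where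
  "lift_op f X Y = down (f (inv down X) (inv down Y))"

text \<open>The chosen representative of a class is interderivable with every other one. Asking
  \<open>f\<close> to respect interderivability, rather than to be monotone, also admits
  \<open>Under\<close> and \<open>Arrow\<close>, which are antitone in the first argument.\<close>

lemma lift_op_down:
  assumes "\<And>\<alpha> \<alpha>' \<beta> \<beta>'. \<alpha> \<turnstile> \<alpha>' \<Longrightarrow> \<alpha>' \<turnstile> \<alpha> \<Longrightarrow> \<beta> \<turnstile> \<beta>' \<Longrightarrow> \<beta>' \<turnstile> \<beta> \<Longrightarrow> f \<alpha> \<beta> \<turnstile> f \<alpha>' \<beta>'"
  shows "lift_op f (down \<alpha>) (down \<beta>) = down (f \<alpha> \<beta>)"
proof -
  have "down (inv down (down \<gamma>)) = down \<gamma>" for \<gamma> :: "'a fm"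
    by (rule f_inv_into_f) simp
  then have "inv down (down \<gamma>) \<turnstile> \<gamma>" "\<gamma> \<turnstile> inv down (down \<gamma>)" for \<gamma> :: "'a fm"
    by (simp_all add: down_eq_iff)
  then show ?thesis
    unfolding lift_op_def down_eq_iff by (blast intro: assms)
qed

definition lindenbaum :: "'v fm set cbrl_alg" where
  "lindenbaum = \<lparr>carr = range down, meet = lift_op And, join = lift_op Or, fus = lift_op Fus,
    under = lift_op Under, star = lift_op Star, arrow = lift_op Arrow,
    bottom = down Bot, topel = down (Arrow Bot Bot)\<rparr>"

lemma lindenbaum_simps [simp]:
  "carr lindenbaum = range down"
  "meet lindenbaum (down \<alpha>) (down \<beta>) = down (And \<alpha> \<beta>)"
  "join lindenbaum (down \<alpha>) (down \<beta>) = down (Or \<alpha> \<beta>)"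
  "fus lindenbaum (down \<alpha>) (down \<beta>) = down (Fus \<alpha> \<beta>)"
  "under lindenbaum (down \<alpha>) (down \<beta>) = down (Under \<alpha> \<beta>)"
  "star lindenbaum (down \<alpha>) (down \<beta>) = down (Star \<alpha> \<beta>)"
  "arrow lindenbaum (down \<alpha>) (down \<beta>) = down (Arrow \<alpha> \<beta>)"
  "bottom lindenbaum = down Bot"
  "topel lindenbaum = down (Arrow Bot Bot)"
  by (simp_all add: lindenbaum_def lift_op_down And_mono Or_mono Fus_mono Under_mono
      Star_mono Arrow_mono)

text \<open>A conjunction is interderivable with its first conjunct exactly when that conjunct
  entails the second.\<close>

lemma leq_lindenbaum: "leq lindenbaum (down \<alpha>) (down \<beta>) \<longleftrightarrow> \<alpha> \<turnstile> \<beta>"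
  by (simp add: leq_def down_eq_iff) (metis entails_And_iff Id)

lemma cbrl_lindenbaum: "cbrl lindenbaum"
proof
  fix a b c :: "'a fm set"
  assume "a \<in> carr lindenbaum" "b \<in> carr lindenbaum"
  then obtain \<alpha> \<beta> where [simp]: "a = down \<alpha>" "b = down \<beta>"
    by auto
  show "meet lindenbaum a b = meet lindenbaum b a"
    by (simp add: down_eq_iff) (metis entails_And_iff Id)
  show "join lindenbaum a b = join lindenbaum b a"
    by (simp add: down_eq_iff) (metis Or_entails_iff Id)
  show "meet lindenbaum a (join lindenbaum a b) = a"
    by (simp add: down_eq_iff) (metis entails_And_iff Or_entails_iff Id)
  show "join lindenbaum a (meet lindenbaum a b) = a"
    by (simp add: down_eq_iff) (metis entails_And_iff Or_entails_iff Id)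
  show "fus lindenbaum a b = fus lindenbaum b a"
    by (simp add: down_eq_iff Fus_comm)
  show "star lindenbaum a b = star lindenbaum b a"
    by (simp add: down_eq_iff Star_comm)
  assume "c \<in> carr lindenbaum"
  then obtain \<gamma> where [simp]: "c = down \<gamma>"
    by auto
  show "meet lindenbaum (meet lindenbaum a b) c = meet lindenbaum a (meet lindenbaum b c)"
    by (simp add: down_eq_iff) (metis entails_And_iff Id)
  show "join lindenbaum (join lindenbaum a b) c = join lindenbaum a (join lindenbaum b c)"
    by (simp add: down_eq_iff) (metis Or_entails_iff Id)
  show "fus lindenbaum (fus lindenbaum a b) c = fus lindenbaum a (fus lindenbaum b c)"
    by (simp add: down_eq_iff Fus_assoc1 Fus_assoc2)
  show "leq lindenbaum (fus lindenbaum a b) c \<longleftrightarrow> leq lindenbaum b (under lindenbaum a c)"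
    by (simp add: leq_lindenbaum Fus_entails_iff_Under)
  show "leq lindenbaum (star lindenbaum a b) c \<longleftrightarrow> leq lindenbaum b (arrow lindenbaum a c)"
    by (simp add: leq_lindenbaum Star_entails_iff_Arrow)
  assume "star lindenbaum (fus lindenbaum a b) c = bottom lindenbaum"
  then show "star lindenbaum (fus lindenbaum a c) b = bottom lindenbaum"
    by (simp add: down_eq_iff Bot_entails Fus_Star_swap)
\<comment> \<open>What remains is closure of the carrier and the two bounds.\<close>
qed (auto simp: leq_lindenbaum Bot_entails entails_Top)

section \<open>The canonical valuation and completeness\<close>

lemma val_lindenbaum: "val lindenbaum (\<lambda>p. down (Var p)) \<alpha> = down \<alpha>"
  by (induction \<alpha>) simp_all

text \<open>Under the canonical valuation every formula denotes its own down-set, so validity in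
  this one algebra is already derivability.\<close>

lemma valid_imp_Gb:
  fixes \<Gamma> :: "'v struct"
  assumes "valid TYPE('v fm set) \<Gamma> \<alpha>"
  shows "Gb \<Gamma> \<alpha>"
proof -
  have "leq lindenbaum (val lindenbaum (\<lambda>p. down (Var p)) (fm_of \<Gamma>))
      (val lindenbaum (\<lambda>p. down (Var p)) \<alpha>)"
    using assms[unfolded valid_def, rule_format, OF cbrl_lindenbaum] by simp
  then have "fm_of \<Gamma> \<turnstile> \<alpha>"
    by (simp add: val_lindenbaum leq_lindenbaum)
  then show ?thesis
    by (rule Gb_trans[OF Gb_fm_of])
qed

text \<open>Completeness needs a single carrier type, that of the Lindenbaum algebra, whereas
  soundness holds over an arbitrary \<open>'a\<close>. Together they make derivability equivalent to
  validity over all types.\<close>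

theorem theorem4:
  fixes \<Gamma> :: "'v struct" and \<alpha> :: "'v fm"
  shows "(Gb \<Gamma> \<alpha> \<longleftrightarrow> valid TYPE('v fm set) \<Gamma> \<alpha>) \<and> (Gb \<Gamma> \<alpha> \<longrightarrow> valid TYPE('a) \<Gamma> \<alpha>)"
proof (intro conjI iffI impI)
  show "Gb \<Gamma> \<alpha>" if "valid TYPE('v fm set) \<Gamma> \<alpha>"
    using that by (rule valid_imp_Gb)
qed (rule Gb_imp_valid, assumption)+

end
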